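(* For a static topological black hole in $d+2$ dimensions with metric functions $f_1,f_2$ and pole-skipping data $E_n(\mu^l)$, $n=1,2$, of a massless scalar (defined in the context), put $f_{aj}=f_a^{(j)}(1)$. For every horizon topology $\kappa\in\{0,1,-1\}$, the first and second derivatives of the metric functions at the horizon are given by $$f_{11}=-\frac{2d\,\omega_1^2}{E_1(\mu)},\qquad f_{21}=\frac{2E_1(\mu)}{d},$$ $$f_{12}=\frac{d\,\omega_1^2}{2E_1(\mu)^3}\Big[(4+8d)E_1(\mu)^2+d\,E_2(\mu^2)-4d\,E_2(\mu)E_1(\mu)\Big],$$ $$f_{22}=-2E_2(\mu)+\frac{3E_2(\mu^2)}{2E_1(\mu)}+\frac{(4d+6)E_1(\mu)}{d}.$$
   Context: Metric: $ds^2=\frac1{z^2}\big(-f_1(z)dt^2+\frac{dz^2}{f_2(z)}+d\Sigma_\kappa^2\big)$ in $d+2$ dimensions, where $d\Sigma_\kappa^2$ is the metric of the $d$-dimensional plane, unit sphere or unit hyperbolic space for $\kappa=0,1,-1$. The horizon is at $z=1$; $f_1,f_2$ are analytic near $z=1$, $f_1(1)=f_2(1)=0$, $f_1'(1)f_2'(1)=(4\pi T)^2$ with $T>0$ the Hawking temperature. A massless scalar $\Phi=e^{-i\omega t}\psi(z)Y(X)$ with $\Delta_\Sigma Y=-\mu Y$ satisfies $A\psi''+B\psi'+C\psi=0$ with $A=f_1f_2$, $B=\frac12(f_1f_2)'-\frac{d}{z}f_1f_2$, $C=\omega^2-\mu f_1$, where $\mu$ is treated as a complex variable. Write $A_j,B_j,C_j$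 for the coefficients of $(z-1)^j$ (zero for $j<0$). Put $\rho=-i\omega/(4\pi T)$ (ingoing exponent) and $$M_{KS}=A_{K-S+3}(\rho+S-1)(\rho+S-2)+B_{K-S+2}(\rho+S-1)+C_{K-S+1},$$ the coefficient of $\phi_{S-1}$ at order $(z-1)^{\rho+K}$ when $\psi=(z-1)^\rho\sum_j\phi_j(z-1)^j$ is inserted. At $\omega=\omega_n=-2\pi iTn$ (so $\rho=-n/2$), $\det(M_{KS})_{1\le K,S\le n}$ is a polynomial of degree $n$ in $\mu$; its roots $\mu_{n1},\dots,\mu_{nn}$ (with multiplicity) are the order-$n$ pole-skipping values, and $E_n(\mu^l)$ is their elementary symmetric polynomial of degree $l$. *)

theory Defs
  imports "HOL-Analysis.Analysis" "Jordan_Normal_Form.Determinant"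
begin

section \<open>Metric and massless scalar\<close>

text \<open>
  A metric is given by its line element: \<open>g p v\<close> is the quadratic form \<open>ds\<^sup>2\<close> at the point \<open>p\<close>
  evaluated on the tangent vector \<open>v\<close>. All metrics below are diagonal in the coordinates used
  (the vectors of \<open>Basis\<close>), so that \<open>g p e\<close>, \<open>e \<in> Basis\<close>, are the only nonzero components.
\<close>

type_synonym 'p line_element = "'p \<Rightarrow> 'p \<Rightarrow> real"

text \<open>
  The \<open>d\<close>-dimensional space of constant curvature \<open>\<kappa>\<close>, \<open>d = DIM('a)\<close>, in conformally flat
  coordinates, valid where \<open>1 + \<kappa> |x|\<^sup>2 / 4 > 0\<close>: the plane for \<open>\<kappa> = 0\<close>, the unit sphere without a
  point (stereographic projection) for \<open>\<kappa> = 1\<close>, the unit hyperbolic space (ball of radius 2) for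
  \<open>\<kappa> = -1\<close>.
\<close>

definition horizon_metric :: "int \<Rightarrow> ('a::euclidean_space) line_element" where
  "horizon_metric \<kappa> x v = (norm v)\<^sup>2 / (1 + of_int \<kappa> / 4 * (norm x)\<^sup>2)\<^sup>2"

text \<open>Coordinates are \<open>(t, z, X)\<close>; the coordinate system is singular at the horizon \<open>z = 1\<close>.\<close>

definition black_hole_metric ::
    "int \<Rightarrow> (real \<Rightarrow> real) \<Rightarrow> (real \<Rightarrow> real) \<Rightarrow> (real \<times> real \<times> 'a::euclidean_space) line_element" where
  "black_hole_metric \<kappa> f1 f2 = (\<lambda>(t, z, x) (dt, dz, dx).
     1 / z\<^sup>2 * (- f1 z * dt\<^sup>2 + dz\<^sup>2 / f2 z + horizon_metric \<kappa> x dx))"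

definition partial_deriv :: "'p::real_normed_vector \<Rightarrow> ('p \<Rightarrow> complex) \<Rightarrow> 'p \<Rightarrow> complex" where
  "partial_deriv e u p = vector_derivative (\<lambda>s. u (p + s *\<^sub>R e)) (at 0)"

definition volume_density :: "('p::euclidean_space) line_element \<Rightarrow> 'p \<Rightarrow> real" where
  "volume_density g p = sqrt (\<Prod>e\<in>Basis. \<bar>g p e\<bar>)"

text \<open>The Laplace-Beltrami (d'Alembert) operator of a metric that is diagonal in the coordinates.\<close>

definition laplace_beltrami ::
    "('p::euclidean_space) line_element \<Rightarrow> ('p \<Rightarrow> complex) \<Rightarrow> 'p \<Rightarrow> complex" where
  "laplace_beltrami g u p =
     (\<Sum>e\<in>Basis. partial_deriv e
        (\<lambda>q. of_real (volume_density g q / g q e) * partial_deriv e u q) p)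
     / of_real (volume_density g p)"


section \<open>Static topological black holes and the radial equation\<close>

definition real_analytic_at :: "(real \<Rightarrow> real) \<Rightarrow> real \<Rightarrow> bool" where
  "real_analytic_at f x \<longleftrightarrow> (\<exists>F. (\<lambda>h. f (x + h)) has_fps_expansion F)"

definition static_topological_black_hole ::
    "int \<Rightarrow> (real \<Rightarrow> real) \<Rightarrow> (real \<Rightarrow> real) \<Rightarrow> real
       \<Rightarrow> (real \<times> real \<times> 'a::euclidean_space) line_element \<Rightarrow> bool" where
  "static_topological_black_hole \<kappa> f1 f2 T g \<longleftrightarrow>
     \<kappa> \<in> {0, 1, -1} \<and> g = black_hole_metric \<kappa> f1 f2 \<and>
     real_analytic_at f1 1 \<and> real_analytic_at f2 1 \<and> f1 1 = 0 \<and> f2 1 = 0 \<and>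
     T > 0 \<and> deriv f1 1 * deriv f2 1 = (4 * pi * T)\<^sup>2"

definition radial_A :: "(real \<Rightarrow> real) \<Rightarrow> (real \<Rightarrow> real) \<Rightarrow> real \<Rightarrow> complex" where
  "radial_A f1 f2 z = of_real (f1 z * f2 z)"

definition radial_B :: "nat \<Rightarrow> (real \<Rightarrow> real) \<Rightarrow> (real \<Rightarrow> real) \<Rightarrow> real \<Rightarrow> complex" where
  "radial_B d f1 f2 z =
     of_real (1 / 2 * deriv (\<lambda>y. f1 y * f2 y) z - real d / z * (f1 z * f2 z))"

definition radial_C :: "(real \<Rightarrow> real) \<Rightarrow> complex \<Rightarrow> complex \<Rightarrow> real \<Rightarrow> complex" where
  "radial_C f1 \<omega> \<mu> z = \<omega>\<^sup>2 - \<mu> * of_real (f1 z)"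

lemma sum_Basis_spacetime:
  fixes F :: "real \<times> real \<times> 'a::euclidean_space \<Rightarrow> 'c::comm_monoid_add"
  shows "(\<Sum>e\<in>Basis. F e) = F (1, 0, 0) + (F (0, 1, 0) + (\<Sum>b\<in>Basis. F (0, 0, b)))"
proof -
  have "(\<Sum>e\<in>Basis. F e) = (\<Sum>e\<in>insert (1, 0, 0) (insert (0, 1, 0) ((\<lambda>b. (0, 0, b)) ` Basis)). F e)"
    by (rule sum.cong) (auto simp: Basis_prod_def zero_prod_def)
  also have "\<dots> = F (1, 0, 0) + (F (0, 1, 0) + (\<Sum>b\<in>Basis. F (0, 0, b)))"
    by (subst sum.insert; (subst sum.insert)?) (auto simp: sum.reindex inj_on_def zero_prod_def)
  finally show ?thesis .
qed

lemma prod_Basis_spacetime: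
  fixes F :: "real \<times> real \<times> 'a::euclidean_space \<Rightarrow> 'c::comm_monoid_mult"
  shows "(\<Prod>e\<in>Basis. F e) = F (1, 0, 0) * (F (0, 1, 0) * (\<Prod>b\<in>Basis. F (0, 0, b)))"
proof -
  have "(\<Prod>e\<in>Basis. F e) = (\<Prod>e\<in>insert (1, 0, 0) (insert (0, 1, 0) ((\<lambda>b. (0, 0, b)) ` Basis)). F e)"
    by (rule prod.cong) (auto simp: Basis_prod_def zero_prod_def)
  also have "\<dots> = F (1, 0, 0) * (F (0, 1, 0) * (\<Prod>b\<in>Basis. F (0, 0, b)))"
    by (subst prod.insert; (subst prod.insert)?) (auto simp: prod.reindex inj_on_def zero_prod_def)
  finally show ?thesis .
qed

lemma volume_density_black_hole:
  fixes x :: "'a::euclidean_space"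
  assumes "z > 0" "f1 z > 0" "f2 z > 0"
  shows "volume_density (black_hole_metric \<kappa> f1 f2) (t, z, x) =
    sqrt (f1 z / f2 z) / z ^ (DIM('a) + 2) * volume_density (horizon_metric \<kappa>) x"
proof -
  define P where "P = (\<Prod>b\<in>(Basis::'a set). \<bar>horizon_metric \<kappa> x b\<bar>)"
  let ?g = "black_hole_metric \<kappa> f1 f2 (t, z, x)"
  have "\<bar>?g (1, 0, 0)\<bar> = f1 z / z\<^sup>2" "\<bar>?g (0, 1, 0)\<bar> = 1 / (f2 z * z\<^sup>2)"
    using assms by (simp_all add: black_hole_metric_def horizon_metric_def abs_mult)
  moreover have "\<bar>?g (0, 0, b)\<bar> = \<bar>horizon_metric \<kappa> x b\<bar> / z\<^sup>2" for b
    by (simp add: black_hole_metric_def)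
  ultimately have "(\<Prod>e\<in>Basis. \<bar>?g e\<bar>) = f1 z / z\<^sup>2 * (1 / (f2 z * z\<^sup>2) * (P / (z\<^sup>2) ^ DIM('a)))"
    by (simp add: prod_Basis_spacetime prod_dividef P_def)
  also have "\<dots> = f1 z / f2 z * (1 / z ^ (DIM('a) + 2))\<^sup>2 * P"
    by (simp add: power_divide power_mult_distrib power_add power2_eq_square)
  finally have "sqrt (\<Prod>e\<in>Basis. \<bar>?g e\<bar>) = sqrt (f1 z / f2 z) * \<bar>1 / z ^ (DIM('a) + 2)\<bar> * sqrt P"
    by (simp only: real_sqrt_mult real_sqrt_abs)
  then show ?thesis
    using assms(1) by (simp add: volume_density_def P_def)
qed

text \<open>
  Separation of variables: for each of the three horizon topologies the massless Klein-Gordon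
  operator acts on \<open>e\<^bsup>-i\<omega>t\<^esup> \<psi>(z) Y(X)\<close>, where \<open>Y\<close> satisfies \<open>\<Delta>\<^sub>\<Sigma> Y = -\<mu> Y\<close>, as the radial operator.
  This is the origin of the coefficients above, and the only place where \<open>\<kappa>\<close> enters.
\<close>

lemma klein_gordon_radial:
  fixes x :: "'a::euclidean_space" and Y :: "'a \<Rightarrow> complex"
  assumes z: "open U" "z \<in> U" "\<And>y. y \<in> U \<Longrightarrow> y > 0 \<and> f1 y > 0 \<and> f2 y > 0"
    and f: "f1 differentiable (at z)" "f2 differentiable (at z)"
    and \<psi>: "\<And>y. y \<in> U \<Longrightarrow> (\<psi> has_vector_derivative \<psi>' y) (at y)"
           "(\<psi>' has_vector_derivative \<psi>'') (at z)"
    and x: "1 + of_int \<kappa> / 4 * (norm x)\<^sup>2 > 0"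
    and Y: "open V" "x \<in> V"
           "\<And>e q. e \<in> Basis \<Longrightarrow> q \<in> V \<Longrightarrow> (\<lambda>s. Y (q + s *\<^sub>R e)) differentiable (at 0)"
           "\<And>e. e \<in> Basis \<Longrightarrow> (\<lambda>s. partial_deriv e Y (x + s *\<^sub>R e)) differentiable (at 0)"
    and eigen: "laplace_beltrami (horizon_metric \<kappa>) Y x = - \<mu> * Y x"
  shows "laplace_beltrami (black_hole_metric \<kappa> f1 f2)
           (\<lambda>(t, z, x). exp (- \<i> * \<omega> * of_real t) * \<psi> z * Y x) (t, z, x) =
         of_real (z\<^sup>2 / f1 z) * exp (- \<i> * \<omega> * of_real t) * Y x *
         (radial_A f1 f2 z * \<psi>'' + radial_B DIM('a) f1 f2 z * \<psi>' z
            + radial_C f1 \<omega> \<mu> z * \<psi> z)"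
proof -
  define \<phi> where "\<phi> s = exp (- \<i> * \<omega> * of_real s)" for s :: real
  define \<Phi> where "\<Phi> = (\<lambda>(t, z, x). \<phi> t * \<psi> z * Y x)"
  define g where "g = (black_hole_metric \<kappa> f1 f2 :: (real \<times> real \<times> 'a) line_element)"
  define h where "h = (horizon_metric \<kappa> :: 'a line_element)"
  define w where "w y = sqrt (f1 y / f2 y) / y ^ (DIM('a) + 2)" for y
  define v where "v = volume_density h"
  define e0 e1 :: "real \<times> real \<times> 'a" where "e0 = (1, 0, 0)" and "e1 = (0, 1, 0)"
  define fl where "fl e q = of_real (volume_density g q / g q e) * partial_deriv e \<Phi> q" for e q
  define c where "c = 1 / (sqrt (f1 z * f2 z) * z ^ DIM('a))"
  define D where "D = deriv (\<lambda>y. f1 y * f2 y) z"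
  have f_pos: "z > 0" "f1 z > 0" "f2 z > 0" using z(3)[OF z(2)] by auto
  have vol: "volume_density g (s, y, q) = w y * v q" if "y \<in> U" for s y q
    using volume_density_black_hole[of y f1 f2 \<kappa> s q] z(3)[OF that]
    by (simp add: g_def w_def v_def h_def)
  have h_eq: "h q b = 1 / (1 + of_int \<kappa> / 4 * (norm q)\<^sup>2)\<^sup>2" if "b \<in> Basis" for b q
    using that by (simp add: h_def horizon_metric_def)
  have h_pos: "h x b > 0" if "b \<in> Basis" for b
    using x by (simp add: h_eq[OF that])
  have v_eq: "v q = sqrt ((1 / (1 + of_int \<kappa> / 4 * (norm q)\<^sup>2)\<^sup>2) ^ DIM('a))" for q
    by (simp add: v_def volume_density_def h_eq)
  have v_pos: "v x > 0" using x by (simp add: v_eq)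
  have w_c: "w z = c * f1 z / z\<^sup>2"
  proof -
    have "sqrt (f1 z / f2 z) = f1 z / sqrt (f1 z * f2 z)"
    proof -
      have "f1 z = sqrt (f1 z) * sqrt (f1 z)" using f_pos by simp
      then have "f1 z / (sqrt (f1 z) * sqrt (f2 z)) = sqrt (f1 z) / sqrt (f2 z)"
        using f_pos by (metis mult_divide_mult_cancel_left real_sqrt_gt_zero less_irrefl)
      then show ?thesis by (simp add: real_sqrt_divide real_sqrt_mult)
    qed
    then show ?thesis by (simp add: w_def c_def power_add power2_eq_square)
  qed
  have c_pos: "c > 0" using f_pos by (simp add: c_def)
  have ev_U: "eventually (\<lambda>s. z + s \<in> U) (nhds 0)"
  proof -
    have "((\<lambda>s. z + s) \<longlongrightarrow> z + 0) (nhds 0)" by (intro tendsto_intros filterlim_ident)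
    from topological_tendstoD[OF this z(1)] z(2) show ?thesis by simp
  qed
  have ev_V: "eventually (\<lambda>s. x + s *\<^sub>R b \<in> V) (nhds 0)" for b
  proof -
    have "((\<lambda>s. x + s *\<^sub>R b) \<longlongrightarrow> x + 0 *\<^sub>R b) (nhds 0)" by (intro tendsto_intros filterlim_ident)
    from topological_tendstoD[OF this Y(1)] Y(2) show ?thesis by simp
  qed
  have ev_deriv: "vector_derivative F (at 0) = F'"
    if "(G has_vector_derivative F') (at 0)" "eventually (\<lambda>r. G r = F r) (nhds 0)"
    for F G :: "real \<Rightarrow> complex" and F'
    using vector_derivative_cong_eq[where f=G and g=F and x=0 and y=0 and A=UNIV and B=UNIV] vector_derivative_at[OF that(1)] that(2)
    by simp
  have shift: "((\<lambda>r. F (y + r)) has_vector_derivative F') (at 0)"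
    if F: "(F has_vector_derivative F') (at y)" for F :: "real \<Rightarrow> complex" and F' y
  proof -
    have "((\<lambda>r. y + r) has_vector_derivative 1) (at 0)"
      by (auto intro!: derivative_eq_intros)
    from vector_diff_chain_at[OF this, of F F'] F show ?thesis by (simp add: o_def)
  qed
  have \<phi>: "((\<lambda>r. \<phi> (s + r)) has_vector_derivative - \<i> * \<omega> * \<phi> s) (at 0)" for s
  proof (rule shift)
    have "((\<lambda>u. - \<i> * \<omega> * u) has_field_derivative - \<i> * \<omega>) (at (of_real s))"
      by (rule DERIV_cmult_Id)
    from DERIV_fun_exp[OF this]
    have "((\<lambda>u. exp (- \<i> * \<omega> * u)) has_field_derivative - \<i> * \<omega> * \<phi> s) (at (of_real s))"
      by (simp add: \<phi>_def mult.commute)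
    then show "(\<phi> has_vector_derivative - \<i> * \<omega> * \<phi> s) (at s)"
      unfolding \<phi>_def by (rule has_vector_derivative_real_field)
  qed

  have dt: "partial_deriv e0 \<Phi> (s, z, x) = - \<i> * \<omega> * \<phi> s * \<psi> z * Y x" for s
  proof -
    have "((\<lambda>r. \<phi> (s + r) * \<psi> z * Y x) has_vector_derivative - \<i> * \<omega> * \<phi> s * \<psi> z * Y x) (at 0)"
      by (intro has_vector_derivative_mult_left \<phi>)
    then show ?thesis
      unfolding partial_deriv_def \<Phi>_def e0_def by (simp add: vector_derivative_at)
  qed
  have part_t: "partial_deriv e0 (fl e0) (t, z, x)
      = of_real (c * v x) * (\<omega>\<^sup>2 * \<phi> t * \<psi> z * Y x)"
  proof -
    have "volume_density g (s, z, x) / g (s, z, x) e0 = - (c * v x)" for s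
      using f_pos vol[OF z(2)]
      by (simp add: g_def black_hole_metric_def e0_def horizon_metric_def w_c)
    then have "fl e0 ((t, z, x) + r *\<^sub>R e0)
        = - of_real (c * v x) * (- \<i> * \<omega> * \<phi> (t + r) * \<psi> z * Y x)" for r
      using dt[of "t + r"] by (simp add: fl_def e0_def)
    moreover have "((\<lambda>r. - of_real (c * v x) * (- \<i> * \<omega> * \<phi> (t + r) * \<psi> z * Y x))
      has_vector_derivative
       (- of_real (c * v x) * (- \<i> * \<omega> * (- \<i> * \<omega> * \<phi> t) * \<psi> z * Y x))) (at 0)"
      by (intro has_vector_derivative_mult_left has_vector_derivative_mult_right \<phi>)
    ultimately have "partial_deriv e0 (fl e0) (t, z, x)
        = - of_real (c * v x) * (- \<i> * \<omega> * (- \<i> * \<omega> * \<phi> t) * \<psi> z * Y x)"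
      unfolding partial_deriv_def by (simp add: vector_derivative_at)
    also have "\<dots> = of_real (c * v x) * ((- (\<i> * \<i>)) * \<omega>\<^sup>2 * \<phi> t * \<psi> z * Y x)"
      by (simp only: power2_eq_square) (simp only: mult_minus_left mult_minus_right mult_ac minus_minus)
    finally show ?thesis by simp
  qed

  have dz: "partial_deriv e1 \<Phi> (t, y, x) = \<phi> t * \<psi>' y * Y x" if "y \<in> U" for y
  proof -
    have "((\<lambda>r. \<phi> t * \<psi> (y + r) * Y x) has_vector_derivative \<phi> t * \<psi>' y * Y x) (at 0)"
      by (intro has_vector_derivative_mult_left has_vector_derivative_mult_right shift \<psi> that)
    then show ?thesis
      unfolding partial_deriv_def \<Phi>_def e1_def by (simp add: vector_derivative_at)
  qed
  define k where "k y = sqrt (f1 y * f2 y) / y ^ DIM('a)" for y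
  define k' where "k' = c * (D / 2 - real DIM('a) / z * (f1 z * f2 z))"
  have k_z: "k z = c * (f1 z * f2 z)"
    using f_pos by (simp add: k_def c_def field_simps)
  have k_w: "w y * (y\<^sup>2 * f2 y) = k y" if "y \<in> U" for y
  proof -
    define p q where "p = sqrt (f1 y)" and "q = sqrt (f2 y)"
    have "y > 0" "q > 0" "f2 y = q * q" using z(3)[OF that] by (auto simp: q_def)
    then show ?thesis
      unfolding w_def k_def real_sqrt_divide real_sqrt_mult p_def[symmetric] q_def[symmetric]
      by (simp add: power_add power2_eq_square)
  qed
  have k': "(k has_real_derivative k') (at z)"
  proof -
    have "(\<lambda>y. f1 y * f2 y) differentiable (at z)" using f by (rule differentiable_mult)
    then have "((\<lambda>y. f1 y * f2 y) has_real_derivative D) (at z)"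
      unfolding D_def by (simp add: DERIV_deriv_iff_real_differentiable)
    from DERIV_chain2[OF DERIV_real_sqrt this]
    have r: "((\<lambda>y. sqrt (f1 y * f2 y)) has_real_derivative
        inverse (sqrt (f1 z * f2 z)) / 2 * D) (at z)"
      using f_pos by simp
    have "((\<lambda>y. y ^ DIM('a)) has_real_derivative real DIM('a) * z ^ (DIM('a) - 1)) (at z)"
      using DERIV_pow[of "DIM('a)" z] by simp
    from DERIV_quotient[OF r this]
    have dk: "(k has_real_derivative
        (inverse (sqrt (f1 z * f2 z)) / 2 * D * z ^ DIM('a)
         - real DIM('a) * z ^ (DIM('a) - 1) * sqrt (f1 z * f2 z)) / (z ^ DIM('a))\<^sup>2) (at z)"
      using f_pos by (simp add: k_def[abs_def] numeral_2_eq_2)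
    define s where "s = sqrt (f1 z * f2 z)"
    define p where "p = z ^ (DIM('a) - 1)"
    have pos: "s > 0" "p > 0" using f_pos by (auto simp: s_def p_def)
    have s2: "f1 z * f2 z = s * s" using f_pos by (simp add: s_def)
    have zp: "z ^ DIM('a) = z * p"
      by (metis DIM_positive power_minus_mult mult.commute p_def)
    have "(inverse s / 2 * D * (z * p) - real DIM('a) * p * s) / (z * p)\<^sup>2
        = 1 / (s * (z * p)) * (D / 2 - real DIM('a) / z * (s * s))"
      using pos f_pos(1) by (simp add: field_simps power2_eq_square)
    then have "k' = (inverse s / 2 * D * (z * p) - real DIM('a) * p * s) / (z * p)\<^sup>2"
      unfolding k'_def c_def s_def[symmetric] s2 zp using pos by simp
    then show ?thesis using dk unfolding s_def[symmetric] p_def[symmetric] zp by simp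
  qed
  have part_z: "partial_deriv e1 (fl e1) (t, z, x)
      = of_real (v x) * \<phi> t * Y x * (of_real (k z) * \<psi>'' + of_real k' * \<psi>' z)"
    unfolding partial_deriv_def
  proof (rule ev_deriv)
    have "((\<lambda>y. complex_of_real (k y)) has_vector_derivative of_real k') (at z)"
      by (rule has_vector_derivative_of_real[OF k'])
    from has_vector_derivative_mult[OF shift[OF this] shift[OF \<psi>(2)]]
    show "((\<lambda>r. of_real (v x) * \<phi> t * Y x * (of_real (k (z + r)) * \<psi>' (z + r)))
      has_vector_derivative
       of_real (v x) * \<phi> t * Y x * (of_real (k z) * \<psi>'' + of_real k' * \<psi>' z)) (at 0)"
      by (intro has_vector_derivative_mult_right) simp
    show "eventually (\<lambda>r. of_real (v x) * \<phi> t * Y x * (of_real (k (z + r)) * \<psi>' (z + r))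
        = fl e1 ((t, z, x) + r *\<^sub>R e1)) (nhds 0)"
      using ev_U
    proof eventually_elim
      case (elim r)
      have "volume_density g (t, z + r, x) / g (t, z + r, x) e1
          = w (z + r) * v x * ((z + r)\<^sup>2 * f2 (z + r))"
        using vol[OF elim] by (simp add: g_def black_hole_metric_def e1_def horizon_metric_def)
      also have "\<dots> = k (z + r) * v x"
        using k_w[OF elim] by (simp add: algebra_simps)
      finally show ?case using dz[OF elim] by (simp add: fl_def e1_def)
    qed
  qed

  have part_x: "partial_deriv (0, 0, b) (fl (0, 0, b)) (t, z, x)
      = of_real (c * f1 z) * \<phi> t * \<psi> z *
        partial_deriv b (\<lambda>q. of_real (v q / h q b) * partial_deriv b Y q) x"
    (is "_ = ?k * partial_deriv b ?G x") if b: "b \<in> Basis" for b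
  proof -
    have dx: "partial_deriv (0, 0, b) \<Phi> (t, z, q) = \<phi> t * \<psi> z * partial_deriv b Y q"
      if "q \<in> V" for q
    proof -
      have "((\<lambda>r. Y (q + r *\<^sub>R b)) has_vector_derivative partial_deriv b Y q) (at 0)"
        unfolding partial_deriv_def using Y(3)[OF b that] vector_derivative_works by blast
      then have "((\<lambda>r. \<phi> t * \<psi> z * Y (q + r *\<^sub>R b)) has_vector_derivative
          \<phi> t * \<psi> z * partial_deriv b Y q) (at 0)"
        by (rule has_vector_derivative_mult_right)
      then show ?thesis
        unfolding partial_deriv_def[of _ \<Phi>] by (simp add: \<Phi>_def vector_derivative_at)
    qed
    have "(\<lambda>r. ?G (x + r *\<^sub>R b)) differentiable (at 0)"
    proof -
      define u where "u r = 1 + of_int \<kappa> / 4 * (norm (x + r *\<^sub>R b))\<^sup>2" for r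
      have u: "(u has_real_derivative of_int \<kappa> / 4 * (2 * (x \<bullet> b))) (at 0)"
      proof -
        have "u = (\<lambda>r. 1 + of_int \<kappa> / 4 * (x \<bullet> x + 2 * r * (x \<bullet> b) + r * r * (b \<bullet> b)))"
          by (rule ext) (simp add: u_def power2_norm_eq_inner inner_add_left inner_add_right
              inner_commute[of b x] algebra_simps)
        then show ?thesis by (auto intro!: derivative_eq_intros)
      qed
      have u0: "u 0 > 0" using x by (simp add: u_def)
      have "(\<lambda>r. sqrt ((1 / (u r)\<^sup>2) ^ DIM('a)) * (u r)\<^sup>2) differentiable (at 0)"
      proof -
        have "(\<lambda>r. (1 / (u r)\<^sup>2) ^ DIM('a)) differentiable (at 0)"
          using u u0 by (intro differentiable_power differentiable_divide differentiable_const)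
            (auto simp: real_differentiable_def)
        then obtain m where "((\<lambda>r. (1 / (u r)\<^sup>2) ^ DIM('a)) has_real_derivative m) (at 0)"
          by (auto simp: real_differentiable_def)
        then have "((\<lambda>r. sqrt ((1 / (u r)\<^sup>2) ^ DIM('a))) has_real_derivative
            inverse (sqrt ((1 / (u 0)\<^sup>2) ^ DIM('a))) / 2 * m) (at 0)"
          using u0 by (intro DERIV_chain2[OF DERIV_real_sqrt]) auto
        then show ?thesis
          using u by (intro differentiable_mult differentiable_power) (auto simp: real_differentiable_def)
      qed
      then have "(\<lambda>r. v (x + r *\<^sub>R b) / h (x + r *\<^sub>R b) b) differentiable (at 0)"
        by (simp add: v_eq h_eq[OF b] u_def)
      then obtain m where
        "((\<lambda>r. v (x + r *\<^sub>R b) / h (x + r *\<^sub>R b) b) has_real_derivative m) (at 0)"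
        by (auto simp: real_differentiable_def)
      then have "(\<lambda>r. complex_of_real (v (x + r *\<^sub>R b) / h (x + r *\<^sub>R b) b)) differentiable (at 0)"
        by (rule differentiableI_vector[OF has_vector_derivative_of_real])
      then show ?thesis using Y(4)[OF b] by (rule differentiable_mult)
    qed
    then have "((\<lambda>r. ?k * ?G (x + r *\<^sub>R b)) has_vector_derivative ?k * partial_deriv b ?G x) (at 0)"
      unfolding partial_deriv_def[of b ?G]
      by (intro has_vector_derivative_mult_right) (simp add: vector_derivative_works)
    then show ?thesis
      unfolding partial_deriv_def[of _ "fl _"]
    proof (rule ev_deriv)
      show "eventually (\<lambda>r. ?k * ?G (x + r *\<^sub>R b) = fl (0, 0, b) ((t, z, x) + r *\<^sub>R (0, 0, b))) (nhds 0)"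
        using ev_V[of b]
      proof eventually_elim
        case (elim r)
        have "volume_density g (t, z, x + r *\<^sub>R b) / g (t, z, x + r *\<^sub>R b) (0, 0, b)
           = c * f1 z * (v (x + r *\<^sub>R b) / h (x + r *\<^sub>R b) b)"
          using vol[OF z(2)] f_pos by (simp add: g_def black_hole_metric_def h_def w_c)
        then show ?case using dx[OF elim] by (simp add: fl_def)
      qed
    qed
  qed

  have "(\<Sum>b\<in>Basis. partial_deriv b (\<lambda>q. of_real (v q / h q b) * partial_deriv b Y q) x)
      = of_real (v x) * (- \<mu> * Y x)"
    using eigen v_pos by (simp add: laplace_beltrami_def h_def v_def field_simps)
  then have "(\<Sum>b\<in>Basis. partial_deriv (0, 0, b) (fl (0, 0, b)) (t, z, x))
      = of_real (c * f1 z) * \<phi> t * \<psi> z * (of_real (v x) * (- \<mu> * Y x))"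
    by (simp add: part_x flip: sum_distrib_left)
  then have "laplace_beltrami g \<Phi> (t, z, x) =
    (of_real (c * v x) * (\<omega>\<^sup>2 * \<phi> t * \<psi> z * Y x)
     + (of_real (v x) * \<phi> t * Y x * (of_real (k z) * \<psi>'' + of_real k' * \<psi>' z)
     + of_real (c * f1 z) * \<phi> t * \<psi> z * (of_real (v x) * (- \<mu> * Y x)))) / of_real (w z * v x)"
    using part_t part_z vol[OF z(2)]
    by (simp add: laplace_beltrami_def sum_Basis_spacetime e0_def e1_def fl_def[abs_def])
  also have "\<dots> = of_real (c * v x) * (\<phi> t * Y x *
        (radial_A f1 f2 z * \<psi>'' + radial_B DIM('a) f1 f2 z * \<psi>' z + radial_C f1 \<omega> \<mu> z * \<psi> z))
       / of_real (w z * v x)"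
    by (simp add: k_z k'_def radial_A_def radial_B_def radial_C_def D_def algebra_simps)
  also have "\<dots> = of_real (z\<^sup>2 / f1 z) * \<phi> t * Y x *
        (radial_A f1 f2 z * \<psi>'' + radial_B DIM('a) f1 f2 z * \<psi>' z + radial_C f1 \<omega> \<mu> z * \<psi> z)"
    using c_pos v_pos f_pos by (simp add: w_c)
  finally show ?thesis by (simp add: g_def \<Phi>_def \<phi>_def)
qed

section \<open>Pole-skipping data\<close>

definition horizon_coeff :: "(real \<Rightarrow> complex) \<Rightarrow> int \<Rightarrow> complex" where
  "horizon_coeff F j =
     (if j < 0 then 0
      else ((\<lambda>G z. vector_derivative G (at z)) ^^ nat j) F 1 / fact (nat j))"

definition pole_skipping_entry ::
    "nat \<Rightarrow> (real \<Rightarrow> real) \<Rightarrow> (real \<Rightarrow> real) \<Rightarrow> real \<Rightarrow> complex \<Rightarrow> complex \<Rightarrow> nat \<Rightarrow> nat \<Rightarrow> complex" where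
  "pole_skipping_entry d f1 f2 T \<omega> \<mu> K S =
     (let \<rho> = - \<i> * \<omega> / of_real (4 * pi * T);
          A = horizon_coeff (radial_A f1 f2);
          B = horizon_coeff (radial_B d f1 f2);
          C = horizon_coeff (radial_C f1 \<omega> \<mu>);
          k = int K; s = int S
      in A (k - s + 3) * (\<rho> + of_int s - 1) * (\<rho> + of_int s - 2)
         + B (k - s + 2) * (\<rho> + of_int s - 1) + C (k - s + 1))"

definition pole_skipping_freq :: "real \<Rightarrow> nat \<Rightarrow> complex" where
  "pole_skipping_freq T n = - 2 * of_real pi * \<i> * of_real T * of_nat n"

text \<open>Matrix indices of \<^const>\<open>mat\<close> start at 0.\<close>

definition pole_skipping_det ::
    "nat \<Rightarrow> (real \<Rightarrow> real) \<Rightarrow> (real \<Rightarrow> real) \<Rightarrow> real \<Rightarrow> nat \<Rightarrow> complex \<Rightarrow> complex" where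
  "pole_skipping_det d f1 f2 T n \<mu> = Determinant.det (mat n n (\<lambda>(i, j).
     pole_skipping_entry d f1 f2 T (pole_skipping_freq T n) \<mu> (i + 1) (j + 1)))"

text \<open>\<open>m 1, \<dots>, m n\<close> are the roots, listed with multiplicity, of the order-\<open>n\<close> determinant.\<close>

definition pole_skipping_values ::
    "nat \<Rightarrow> (real \<Rightarrow> real) \<Rightarrow> (real \<Rightarrow> real) \<Rightarrow> real \<Rightarrow> nat \<Rightarrow> (nat \<Rightarrow> complex) \<Rightarrow> bool" where
  "pole_skipping_values d f1 f2 T n m \<longleftrightarrow>
     (\<exists>p. (\<forall>\<mu>. poly p \<mu> = pole_skipping_det d f1 f2 T n \<mu>) \<and>
          proots p = image_mset m (mset_set {1..n}))"

definition elem_sym :: "nat \<Rightarrow> nat \<Rightarrow> (nat \<Rightarrow> complex) \<Rightarrow> complex" where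
  "elem_sym n l m = (\<Sum>I | I \<subseteq> {1..n} \<and> card I = l. \<Prod>i\<in>I. m i)"

end

theory Submission
  imports Defs "HOL-Computational_Algebra.Fundamental_Theorem_Algebra"
begin

text \<open>
  In the matrix of order 2 the coefficient \<open>A\<^sub>4\<close> of \<open>f1 f2\<close> cancels, so with
  \<open>f1'(1) = a\<close>, \<open>f2'(1) = b\<close> the first two determinants involve only the first two derivatives of
  the metric functions at the horizon. The root of the linear determinant is \<open>d b / 2\<close>, and \<open>a\<close>
  follows from the temperature. By Vieta, the sum and product of the roots of the quadratic
  determinant are affine in the second derivatives, and this \<open>2 \<times> 2\<close> system is inverted.
\<close>

section \<open>Taylor coefficients at the horizon\<close>

lemma has_fps_expansion_nth_0:
  assumes "f has_fps_expansion F"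
  shows "f 0 = fps_nth F 0"
  using eventually_nhds_x_imp_x[of "\<lambda>z. eval_fps F z = f z" 0] assms
  by (simp add: has_fps_expansion_def eval_fps_at_0)

text \<open>\<open>deriv\<close> is informative only where the derivative exists. Differentiability
  is required at every point near \<open>x\<close>, since the next derivative looks at
  \<open>deriv f\<close> on a neighbourhood.\<close>

lemma has_fps_expansion_shift_DERIV:
  fixes f :: "real \<Rightarrow> real"
  assumes "(\<lambda>h. f (x + h)) has_fps_expansion F"
  shows "eventually (\<lambda>z. (f has_real_derivative deriv f z) (at z)) (nhds x)"
proof -
  have "eventually (\<lambda>h. h \<in> eball 0 (fps_conv_radius F)) (nhds 0)"
    using assms by (intro eventually_nhds_in_open) (auto simp: has_fps_expansion_def zero_ereal_def)
  \<comment> \<open>To transfer the derivative at \<open>h\<close>, the series must agree with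
    \<open>f\<close> on a neighbourhood of \<open>h\<close>, hence the nested
    \<open>eventually\<close>.\<close>
  moreover have "eventually (\<lambda>h. eventually (\<lambda>r. eval_fps F r = f (x + r)) (nhds h)) (nhds 0)"
    using assms by (simp add: has_fps_expansion_def eventually_eventually)
  ultimately have "eventually (\<lambda>h. (f has_real_derivative deriv f (x + h)) (at (x + h))) (nhds 0)"
  proof eventually_elim
    case (elim h)
    have "(eval_fps F has_real_derivative eval_fps (fps_deriv F) h) (at h)"
      using elim(1) by (intro has_field_derivative_eval_fps) auto
    then have "((\<lambda>r. f (x + r)) has_real_derivative eval_fps (fps_deriv F) h) (at h)"
      using DERIV_cong_ev[OF refl elim(2) refl] by blast
    then have "(f has_real_derivative eval_fps (fps_deriv F) h) (at (x + h))"
      using DERIV_shift[of f _ h x] by (simp add: add.commute)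
    then show ?case using DERIV_imp_deriv by metis
  qed
  moreover have "nhds x = filtermap (\<lambda>h. x + h) (nhds 0)"
    using filtermap_nhds_shift[of "- x" 0] by (simp add: add.commute)
  ultimately show ?thesis by (simp add: eventually_filtermap)
qed

lemma has_fps_expansion_shift_deriv:
  fixes f :: "real \<Rightarrow> real"
  assumes "(\<lambda>h. f (x + h)) has_fps_expansion F"
  shows "(\<lambda>h. deriv f (x + h)) has_fps_expansion fps_deriv F"
proof -
  \<comment> \<open>\<open>DERIV_shift\<close> is an equivalence, so the identity holds at every
    \<open>h\<close>, even where \<open>f\<close> is not differentiable.\<close>
  have "deriv (\<lambda>h. f (x + h)) h = deriv f (x + h)" for h
    unfolding deriv_def using DERIV_shift[of f _ h x] by (simp add: add.commute)
  then have "deriv (\<lambda>h. f (x + h)) = (\<lambda>h. deriv f (x + h))" by (rule ext)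
  then show ?thesis using has_fps_expansion_deriv[OF assms] by simp
qed

text \<open>The affine form covers all radial coefficients: \<mu> and \<omega> enter only through
  the constants \<open>a\<close> and \<open>c\<close>. The first differentiation kills
  \<open>c\<close>, so the induction hypothesis is applied with \<open>c = 0\<close>.\<close>

lemma higher_vector_derivative_fps_nth:
  fixes f :: "real \<Rightarrow> real" and a c :: complex
  assumes "(\<lambda>h. f (x + h)) has_fps_expansion F"
    and "eventually (\<lambda>z. G z = c + a * of_real (f z)) (nhds x)"
  shows "((\<lambda>G z. vector_derivative G (at z)) ^^ n) G x
    = (if n = 0 then c else 0) + a * of_real (fact n * fps_nth F n)"
  using assms
proof (induction n arbitrary: f F G c)
  case 0
  then show ?case
    using eventually_nhds_x_imp_x[OF 0(2)] has_fps_expansion_nth_0[OF 0(1)] by simp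
next
  case (Suc n)
  have "eventually (\<lambda>z. eventually (\<lambda>y. G y = c + a * of_real (f y)) (nhds z)) (nhds x)"
    using Suc.prems(2) by (simp add: eventually_eventually)
  with has_fps_expansion_shift_DERIV[OF Suc.prems(1)]
  have ev: "eventually (\<lambda>z. vector_derivative G (at z) = 0 + a * of_real (deriv f z)) (nhds x)"
  proof eventually_elim
    case (elim z)
    have "((\<lambda>y. c + a * of_real (f y)) has_vector_derivative 0 + a * of_real (deriv f z)) (at z)"
      by (intro has_vector_derivative_add has_vector_derivative_const
          has_vector_derivative_mult_right has_vector_derivative_of_real elim(1))
    then show ?case
      using vector_derivative_cong_eq[where f = G and g = "\<lambda>y. c + a * of_real (f y)"
          and x = z and y = z and A = UNIV and B = UNIV] elim(2)
      by (simp add: vector_derivative_at)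
  qed
  show ?case
    using Suc.IH[OF has_fps_expansion_shift_deriv[OF Suc.prems(1)] ev]
    by (simp add: funpow_Suc_right algebra_simps del: funpow.simps)
qed

lemma horizon_coeff_fps_nth:
  assumes "(\<lambda>h. f (1 + h)) has_fps_expansion F"
    and "\<And>z. G z = c + a * of_real (f z)"
  shows "horizon_coeff G j =
    (if j < 0 then 0 else (if j = 0 then c else 0) + a * of_real (fps_nth F (nat j)))"
  using higher_vector_derivative_fps_nth[OF assms(1), of G c a "nat j"] assms(2)
  by (simp add: horizon_coeff_def)

lemma higher_deriv_fps_nth:
  fixes f :: "real \<Rightarrow> real"
  assumes "(\<lambda>h. f (x + h)) has_fps_expansion F"
  shows "(deriv ^^ n) f x = fact n * fps_nth F n"
  using assms
proof (induction n arbitrary: f F)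
  case 0
  then show ?case using has_fps_expansion_nth_0[OF 0] by simp
next
  case (Suc n)
  show ?case
    using Suc.IH[OF has_fps_expansion_shift_deriv[OF Suc.prems]]
    by (simp add: funpow_Suc_right algebra_simps del: funpow.simps)
qed


section \<open>Determinants, roots and symmetric polynomials of low order\<close>

lemma det_mat_1: "Determinant.det (mat 1 1 f) = f (0, 0)"
  by (subst det_single) auto

lemma det_mat_2:
  fixes f :: "nat \<times> nat \<Rightarrow> 'b::comm_ring_1"
  shows "Determinant.det (mat 2 2 f) = f (0, 0) * f (1, 1) - f (0, 1) * f (1, 0)"
proof -
  \<comment> \<open>With indices 0 and 1, the entry left after deleting row \<open>i\<close> and
    column \<open>j\<close> is the one at \<open>(1 - i, 1 - j)\<close>.\<close>
  have "mat_delete (mat 2 2 f) i j = mat 1 1 (\<lambda>_. f (1 - i, 1 - j))" if "i < 2" "j < 2" for i j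
    using that by (intro eq_matI) (auto simp: mat_delete_def less_2_cases_iff)
  moreover have "{..<2} = {0, 1::nat}" by auto
  ultimately show ?thesis
    using laplace_expansion_row[of "mat 2 2 f" 2 0] by (simp add: cofactor_def det_mat_1[unfolded One_nat_def])
qed

lemma proots_linear:
  fixes p :: "complex poly"
  assumes "\<And>x. poly p x = c0 + c1 * x" "c1 \<noteq> 0" "proots p = {#r#}"
  shows "r = - c0 / c1"
proof -
  \<comment> \<open>Only the values of \<open>p\<close> are given; over an infinite field they
    determine its coefficients.\<close>
  have "poly p = poly [:c0, c1:]" using assms(1) by (auto simp: algebra_simps)
  then have p: "p = [:c0, c1:]" by (simp only: poly_eq_poly_eq_iff)
  have "c0 = - c1 * r"
    using complex_poly_decompose_multiset[of p] assms(2,3) by (simp add: p)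
  then show ?thesis using assms(2) by simp
qed

text \<open>Vieta's formulas: \<open>p\<close> is \<open>c2\<close> times the product of the linear
  factors over \<open>proots p\<close>. Multiplicity is part of the multiset, so
  \<open>r = s\<close> is allowed.\<close>

lemma proots_quadratic:
  fixes p :: "complex poly"
  assumes "\<And>x. poly p x = c0 + c1 * x + c2 * x\<^sup>2" "c2 \<noteq> 0" "proots p = {#r, s#}"
  shows "r + s = - c1 / c2" "r * s = c0 / c2"
proof -
  have "poly p = poly [:c0, c1, c2:]"
    using assms(1) by (auto simp: algebra_simps power2_eq_square)
  then have p: "p = [:c0, c1, c2:]" by (simp only: poly_eq_poly_eq_iff)
  have "c0 = c2 * (r * s)" "c1 = - c2 * (r + s)"
    using complex_poly_decompose_multiset[of p] assms(2,3) by (auto simp: p algebra_simps)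
  then show "r + s = - c1 / c2" "r * s = c0 / c2" using assms(2) by simp_all
qed

lemma elem_sym_1: "elem_sym n 1 m = (\<Sum>i\<in>{1..n}. m i)"
proof -
  have "{I. I \<subseteq> {1..n} \<and> card I = 1} = (\<lambda>i. {i}) ` {1..n}"
    by (auto simp: card_1_singleton_iff)
  then show ?thesis by (simp add: elem_sym_def sum.reindex)
qed

lemma elem_sym_full: "elem_sym n n m = (\<Prod>i\<in>{1..n}. m i)"
proof -
  have "{I. I \<subseteq> {1..n} \<and> card I = n} = {{1..n}}"
    using card_subset_eq[of "{1..n}"] by auto
  then show ?thesis by (simp add: elem_sym_def)
qed


section \<open>The first two pole-skipping determinants\<close>

text \<open>All matrix entries are read off from power series in h = z - 1. Note that
  \<open>a'\<close> and \<open>b'\<close> are Taylor coefficients, that is, half the second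
  derivatives.\<close>

lemma pole_skipping_det_1_2:
  assumes F: "(\<lambda>h. f1 (1 + h)) has_fps_expansion F1" "(\<lambda>h. f2 (1 + h)) has_fps_expansion F2"
    and zero: "fps_nth F1 0 = 0" "fps_nth F2 0 = 0"
    and T: "T > 0" "fps_nth F1 1 * fps_nth F2 1 = (4 * pi * T)\<^sup>2"
  defines "a \<equiv> complex_of_real (fps_nth F1 1)" and "b \<equiv> complex_of_real (fps_nth F2 1)"
    and "a' \<equiv> complex_of_real (fps_nth F1 2)" and "b' \<equiv> complex_of_real (fps_nth F2 2)"
  shows "pole_skipping_det d f1 f2 T 1 \<mu> = of_nat d * (a * b) / 2 - a * \<mu>"
    and "pole_skipping_det d f1 f2 T 2 \<mu> =
      of_nat d * (a * b) * (a * b' + a' * b - a * b)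
      - (a * (a * b' + a' * b) / 2 + of_nat d * (a * b) * a + a * b * a') * \<mu>
      + a\<^sup>2 * \<mu>\<^sup>2"
proof -
  define P where "P = F1 * F2"
  \<comment> \<open>\<open>Q\<close> is the expansion of the coefficient B; the factor 1/z becomes
    \<open>inverse (1 + fps_X)\<close>.\<close>
  define Q where "Q = fps_const (1 / 2) * fps_deriv P - fps_const (real d) * (inverse (1 + fps_X) * P)"
  have P: "(\<lambda>h. f1 (1 + h) * f2 (1 + h)) has_fps_expansion P"
    unfolding P_def by (intro has_fps_expansion_mult F)
  have Q: "(\<lambda>h. 1 / 2 * deriv (\<lambda>y. f1 y * f2 y) (1 + h)
      - real d * (inverse (1 + h) * (f1 (1 + h) * f2 (1 + h)))) has_fps_expansion Q"
  proof -
    have "(\<lambda>h::real. inverse (1 + h)) has_fps_expansion inverse (1 + fps_X)"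
      using has_fps_expansion_inverse[OF
          has_fps_expansion_add[OF has_fps_expansion_1 has_fps_expansion_fps_X]]
      by simp
    then show ?thesis
      unfolding Q_def
      by (intro has_fps_expansion_diff has_fps_expansion_cmult_left has_fps_expansion_mult[OF _ P]
          has_fps_expansion_shift_deriv[where f = "\<lambda>y. f1 y * f2 y", OF P])
  qed
  \<comment> \<open>Both metric functions vanish at the horizon, so their product starts at order
    2.\<close>
  have P_nth: "fps_nth P 0 = 0" "fps_nth P 1 = 0" "fps_nth P 2 = fps_nth F1 1 * fps_nth F2 1"
      "fps_nth P 3 = fps_nth F1 1 * fps_nth F2 2 + fps_nth F1 2 * fps_nth F2 1"
    unfolding P_def fps_mult_nth eval_nat_numeral BitM.simps One_nat_def
    by (simp_all add: zero sum.atLeast0_atMost_Suc)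
  define R where "R = inverse (1 + fps_X) * P"
  \<comment> \<open>Multiplying by \<open>1 + fps_X\<close> gives a recurrence for the coefficients
    and avoids expanding the inverse.\<close>
  have R_rec: "fps_nth R n = fps_nth P n - (if n = 0 then 0 else fps_nth R (n - 1))" for n
  proof -
    have "inverse (1 + fps_X) * (1 + fps_X) = (1 :: real fps)"
      by (rule inverse_mult_eq_1) simp
    then have "(1 + fps_X) * R = P"
      unfolding R_def by (metis mult.commute mult.assoc mult_1_left)
    then have "fps_nth (R + fps_X * R) n = fps_nth P n" by (simp add: distrib_right)
    then show ?thesis by (simp add: algebra_simps)
  qed
  have R_nth: "fps_nth R 0 = 0" "fps_nth R 1 = 0" "fps_nth R 2 = fps_nth P 2"
      "fps_nth R 3 = fps_nth P 3 - fps_nth P 2"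
    using R_rec[of 0] R_rec[of 1] R_rec[of 2] R_rec[of 3] P_nth(1,2) by simp_all
  have Q_nth: "fps_nth Q 0 = 0" "fps_nth Q 1 = fps_nth P 2"
      "fps_nth Q 2 = 3 / 2 * fps_nth P 3 - real d * fps_nth P 2"
      "fps_nth Q 3 = 2 * fps_nth P 4 - real d * (fps_nth P 3 - fps_nth P 2)"
    using P_nth(2) R_nth by (simp_all add: Q_def eval_nat_numeral flip: R_def)
  have A: "horizon_coeff (radial_A f1 f2) j = (if j < 0 then 0 else of_real (fps_nth P (nat j)))" for j
    by (subst horizon_coeff_fps_nth[where f = "\<lambda>z. f1 z * f2 z" and c = 0 and a = 1, OF P])
       (simp_all add: radial_A_def)
  have B: "horizon_coeff (radial_B d f1 f2) j = (if j < 0 then 0 else of_real (fps_nth Q (nat j)))" for j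
    by (subst horizon_coeff_fps_nth[where c = 0 and a = 1 and
          f = "\<lambda>z. 1 / 2 * deriv (\<lambda>y. f1 y * f2 y) z - real d * (inverse z * (f1 z * f2 z))", OF Q])
       (simp_all add: radial_B_def divide_inverse[of "of_nat d"] mult.assoc)
  have C: "horizon_coeff (radial_C f1 \<omega> \<mu>) j =
      (if j < 0 then 0 else (if j = 0 then \<omega>\<^sup>2 else 0) - \<mu> * of_real (fps_nth F1 (nat j)))" for \<omega> \<mu> j
    by (subst horizon_coeff_fps_nth[where f = f1 and c = "\<omega>\<^sup>2" and a = "- \<mu>", OF F(1)])
       (simp_all add: radial_C_def)
  \<comment> \<open>The exponent is -n/2. For n = 2 this makes \<rho> + 1 = 0, so the second column
    retains only the coefficients of C.\<close>
  have \<rho>: "- \<i> * pole_skipping_freq T n / of_real (4 * pi * T) = - of_nat n / 2" for n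
    using T(1) by (simp add: pole_skipping_freq_def field_simps)
  note entry = pole_skipping_entry_def[of d f1 f2 T "pole_skipping_freq T n" for n, unfolded \<rho> Let_def A B C]
  \<comment> \<open>With \<rho> = -1/2 the third coefficient of \<open>P\<close> contributes 3/4
    through A and -3/4 through B, so no second derivative survives.\<close>
  show "pole_skipping_det d f1 f2 T 1 \<mu> = of_nat d * (a * b) / 2 - a * \<mu>"
    unfolding pole_skipping_det_def det_mat_1
    by (simp add: entry P_nth Q_nth zero a_def b_def field_simps)
  have freq: "(pole_skipping_freq T 2)\<^sup>2 = - (a * b)"
    using T(2) unfolding a_def b_def of_real_mult[symmetric]
    by (simp add: pole_skipping_freq_def power_mult_distrib)
  \<comment> \<open>The fourth coefficient of \<open>P\<close> occurs only in the lower left entry,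
    as 2 from A and -2 from B. The upper right entry is the squared frequency, replaced by
    \<open>- (a * b)\<close>.\<close>
  show "pole_skipping_det d f1 f2 T 2 \<mu> =
      of_nat d * (a * b) * (a * b' + a' * b - a * b)
      - (a * (a * b' + a' * b) / 2 + of_nat d * (a * b) * a + a * b * a') * \<mu>
      + a\<^sup>2 * \<mu>\<^sup>2"
    unfolding pole_skipping_det_def det_mat_2
    by (simp add: entry P_nth Q_nth zero freq)
       (simp add: a_def b_def a'_def b'_def field_simps power2_eq_square)
qed

theorem mainTheorem3:
  fixes f1 f2 :: "real \<Rightarrow> real" and T :: real and \<kappa> :: int and d :: nat
    and g :: "(real \<times> real \<times> 'a::euclidean_space) line_element"
    and \<mu> :: "nat \<Rightarrow> nat \<Rightarrow> complex" and E :: "nat \<Rightarrow> nat \<Rightarrow> complex" and \<omega>1 :: complex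
  assumes dim: "d = DIM('a)"
    and bh: "static_topological_black_hole \<kappa> f1 f2 T g"
    and roots: "\<And>n. n \<in> {1, 2} \<Longrightarrow> pole_skipping_values d f1 f2 T n (\<mu> n)"
    and E: "\<And>n l. E n l = elem_sym n l (\<mu> n)"
    and \<omega>1: "\<omega>1 = pole_skipping_freq T 1"
  shows "of_real ((deriv ^^ 1) f1 1) = - (2 * of_nat d * \<omega>1\<^sup>2) / E 1 1
    \<and> of_real ((deriv ^^ 1) f2 1) = 2 * E 1 1 / of_nat d
    \<and> of_real ((deriv ^^ 2) f1 1) = of_nat d * \<omega>1\<^sup>2 / (2 * (E 1 1) ^ 3) *
         ((4 + 8 * of_nat d) * (E 1 1)\<^sup>2 + of_nat d * E 2 2 - 4 * of_nat d * E 2 1 * E 1 1)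
    \<and> of_real ((deriv ^^ 2) f2 1) = - 2 * E 2 1 + 3 * E 2 2 / (2 * E 1 1)
         + (4 * of_nat d + 6) * E 1 1 / of_nat d"
proof -
  from bh have T: "T > 0" "deriv f1 1 * deriv f2 1 = (4 * pi * T)\<^sup>2"
    and f0: "f1 1 = 0" "f2 1 = 0"
    and "\<exists>F. (\<lambda>h. f1 (1 + h)) has_fps_expansion F" "\<exists>F. (\<lambda>h. f2 (1 + h)) has_fps_expansion F"
    by (auto simp: static_topological_black_hole_def real_analytic_at_def)
  then obtain F1 F2 where F: "(\<lambda>h. f1 (1 + h)) has_fps_expansion F1"
      "(\<lambda>h. f2 (1 + h)) has_fps_expansion F2"
    by blast
  have zero: "fps_nth F1 0 = 0" "fps_nth F2 0 = 0"
    using f0 has_fps_expansion_nth_0[OF F(1)] has_fps_expansion_nth_0[OF F(2)] by simp_all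
  have D: "(deriv ^^ n) f1 1 = fact n * fps_nth F1 n" "(deriv ^^ n) f2 1 = fact n * fps_nth F2 n" for n
    using higher_deriv_fps_nth[where f = f1, OF F(1)] higher_deriv_fps_nth[where f = f2, OF F(2)] by auto
  have TF: "fps_nth F1 1 * fps_nth F2 1 = (4 * pi * T)\<^sup>2"
    using T(2) D[of 1] by simp
  define a b a' b' where "a = complex_of_real (fps_nth F1 1)" and "b = complex_of_real (fps_nth F2 1)"
    and "a' = complex_of_real (fps_nth F1 2)" and "b' = complex_of_real (fps_nth F2 2)"
  note det = pole_skipping_det_1_2[OF F zero T(1) TF, folded a_def b_def a'_def b'_def]
  have ab: "a * b = - 4 * \<omega>1\<^sup>2"
    using TF unfolding a_def b_def of_real_mult[symmetric]
    by (simp add: \<omega>1 pole_skipping_freq_def power_mult_distrib)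
  have nz: "a \<noteq> 0" "b \<noteq> 0" "complex_of_nat d \<noteq> 0"
    using TF T(1) dim by (auto simp: a_def b_def)
  obtain p where p: "\<And>x. poly p x = pole_skipping_det d f1 f2 T 1 x" "proots p = {#\<mu> 1 1#}"
    using roots[of 1] by (auto simp: pole_skipping_values_def)
  have "\<mu> 1 1 = - (of_nat d * (a * b) / 2) / (- a)"
  proof (rule proots_linear[OF _ _ p(2)])
    show "poly p x = of_nat d * (a * b) / 2 + - a * x" for x
      unfolding p(1) det(1) by simp
  qed (use nz in simp)
  moreover have "E 1 1 = \<mu> 1 1" unfolding E elem_sym_1 by simp
  ultimately have E11: "E 1 1 = of_nat d * b / 2" using nz by simp
  have "mset_set {1..2::nat} = {#1, 2#}"
    by (simp add: numeral_2_eq_2 atLeastAtMostSuc_conv)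
  then obtain q where q: "\<And>x. poly q x = pole_skipping_det d f1 f2 T 2 x"
      "proots q = {#\<mu> 2 1, \<mu> 2 2#}"
    using roots[of 2] by (auto simp: pole_skipping_values_def)
  have "poly q x = of_nat d * (a * b) * (a * b' + a' * b - a * b)
      + (- (a * (a * b' + a' * b) / 2 + of_nat d * (a * b) * a + a * b * a')) * x + a\<^sup>2 * x\<^sup>2" for x
    unfolding q(1) det(2) by (simp add: algebra_simps)
  note vieta = proots_quadratic[OF this _ q(2)]
  have E2: "E 2 1 = \<mu> 2 1 + \<mu> 2 2" "E 2 2 = \<mu> 2 1 * \<mu> 2 2"
    unfolding E elem_sym_1 elem_sym_full by (simp_all add: numeral_2_eq_2)
  \<comment> \<open>With u = a' b / a, these say E21 = b'/2 + 3u/2 + d b and E22 = d b (b' + u - b).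
    The combination -2 E21 + 3 E22 / (d b) eliminates u, and E21 - E22 / (2 d b) eliminates b'; here
    d b = 2 E11.\<close>
  have E21: "E 2 1 = (a * (a * b' + a' * b) / 2 + of_nat d * (a * b) * a + a * b * a') / a\<^sup>2"
    unfolding E2 using vieta(1) nz by simp
  have E22: "E 2 2 = of_nat d * (a * b) * (a * b' + a' * b - a * b) / a\<^sup>2"
    unfolding E2 using vieta(2) nz by simp
  \<comment> \<open>Removing the frequency turns the claims into rational identities in
    \<open>a\<close>, \<open>b\<close>, \<open>a'\<close>, \<open>b'\<close> and \<open>d\<close>,
    with nonzero denominators by \<open>nz\<close>.\<close>
  have \<omega>: "\<omega>1\<^sup>2 = - (a * b) / 4" using ab by simp
  have "a = - (2 * of_nat d * \<omega>1\<^sup>2) / E 1 1" "b = 2 * E 1 1 / of_nat d"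
    using nz unfolding E11 \<omega> by simp_all
  moreover have "2 * a' = of_nat d * \<omega>1\<^sup>2 / (2 * (E 1 1) ^ 3) *
      ((4 + 8 * of_nat d) * (E 1 1)\<^sup>2 + of_nat d * E 2 2 - 4 * of_nat d * E 2 1 * E 1 1)"
    using nz unfolding E11 E21 E22 \<omega>
    by (simp add: divide_simps) (simp add: power2_eq_square power3_eq_cube algebra_simps)
  moreover have "2 * b' = - 2 * E 2 1 + 3 * E 2 2 / (2 * E 1 1)
      + (4 * of_nat d + 6) * E 1 1 / of_nat d"
    using nz unfolding E11 E21 E22
    by (simp add: divide_simps) (simp add: power2_eq_square algebra_simps)
  ultimately show ?thesis
    using D[of 1] D[of 2] by (simp add: a_def b_def a'_def b'_def)
qed

end
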